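(* Let $p\in(1,\infty)$ and let $(V,\mu)$ be an infinite, connected, locally finite weighted graph. Then: (a) there exists a nonconstant bounded $p$-harmonic function on $V$ if and only if there exist two disjoint infinite subsets of $V$ that are both $p$-massive; (b) there exists a nonconstant bounded $p$-harmonic function $u$ on $V$ with finite $p$-energy $D_p(u)<\infty$ if and only if there exist two disjoint infinite subsets of $V$ that are both $D_p$-massive.
   Context: Weighted graph: $G=(V,E)$ is a graph, $x\sim y$ means that $x,y$ are joined by an edge, and $\mu:V\times V\to[0,\infty)$, $\mu_{xy}=\mu(x,y)=\mu_{yx}$, satisfies $\mu_{xy}>0$ if and only if $x\sim y$. Vertex measure: $\mu(x)=\sum_{y\sim x}\mu_{xy}$. $\Omega^c=V\setminus\Omega$. For $u:V\to\mathbb R$, write $\nabla_{xy}u=u(y)-u(x)$ and $\Delta_pu(x)=\frac1{\mu(x)}\sum_{y\sim x}\mu_{xy}|\nabla_{xy}u|^{p-2}\nabla_{xy}u$ (a summand is $0$ when $\nabla_{xy}u=0$). $u$ is $p$-harmonic on $V$ if $\Delta_pu(x)=0$ for all $x\in V$. The $p$-energy is $D_p(f)=\frac12\sum_{x,y\in V}\mu_{xy}|f(x)-f(y)|^p$. $p$-massive: $\Omega\subset V$ is $p$-massive if there is $u:V\to\mathbb R$ with $0<u<1$ in $\Omega$, $\Delta_pu=0$ on $\Omega$, and $u=1$ on $\Omega^c$. If in addition such a $u$ can be chosen with $D_p(u)<\infty$, then $\Omega$ is $D_p$-massive. *)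

theory Defs
  imports "HOL-Analysis.Analysis"
begin

text \<open>The vertex set \<open>V\<close> is the universe of the type \<open>'v\<close>. Loops are not excluded: they
  contribute neither to the Laplacian sum nor to the energy, only to the vertex measure.\<close>

locale weighted_graph =
  fixes E :: "'v \<Rightarrow> 'v \<Rightarrow> bool" and \<mu> :: "'v \<Rightarrow> 'v \<Rightarrow> real"
  assumes edge_sym: "E x y \<Longrightarrow> E y x"
    and weight_nonneg: "\<mu> x y \<ge> 0"
    and weight_sym: "\<mu> x y = \<mu> y x"
    and weight_pos_iff: "\<mu> x y > 0 \<longleftrightarrow> E x y"

definition graph_connected :: "('v \<Rightarrow> 'v \<Rightarrow> bool) \<Rightarrow> bool" where
  "graph_connected E \<longleftrightarrow> (\<forall>x y. E\<^sup>*\<^sup>* x y)"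

definition locally_finite :: "('v \<Rightarrow> 'v \<Rightarrow> bool) \<Rightarrow> bool" where
  "locally_finite E \<longleftrightarrow> (\<forall>x. finite {y. E x y})"

definition vertex_measure :: "('v \<Rightarrow> 'v \<Rightarrow> bool) \<Rightarrow> ('v \<Rightarrow> 'v \<Rightarrow> real) \<Rightarrow> 'v \<Rightarrow> real" where
  "vertex_measure E \<mu> x = (\<Sum>y | E x y. \<mu> x y)"

definition grad :: "('v \<Rightarrow> real) \<Rightarrow> 'v \<Rightarrow> 'v \<Rightarrow> real" where
  "grad u x y = u y - u x"

text \<open>Summands with zero gradient vanish also for \<open>p < 2\<close>, because \<open>0 powr a = 0\<close>.\<close>

definition p_laplacian ::
  "real \<Rightarrow> ('v \<Rightarrow> 'v \<Rightarrow> bool) \<Rightarrow> ('v \<Rightarrow> 'v \<Rightarrow> real) \<Rightarrow> ('v \<Rightarrow> real) \<Rightarrow> 'v \<Rightarrow> real" where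
  "p_laplacian p E \<mu> u x =
     1 / vertex_measure E \<mu> x * (\<Sum>y | E x y. \<mu> x y * \<bar>grad u x y\<bar> powr (p - 2) * grad u x y)"

definition p_harmonic_on ::
  "real \<Rightarrow> ('v \<Rightarrow> 'v \<Rightarrow> bool) \<Rightarrow> ('v \<Rightarrow> 'v \<Rightarrow> real) \<Rightarrow> 'v set \<Rightarrow> ('v \<Rightarrow> real) \<Rightarrow> bool" where
  "p_harmonic_on p E \<mu> \<Omega> u \<longleftrightarrow> (\<forall>x\<in>\<Omega>. p_laplacian p E \<mu> u x = 0)"

text \<open>The energy is an unordered sum of nonnegative terms, taken in \<open>ennreal\<close> so that it always
  exists and is \<open>\<infinity>\<close> exactly when the sum diverges.\<close>

definition p_energy :: "real \<Rightarrow> ('v \<Rightarrow> 'v \<Rightarrow> real) \<Rightarrow> ('v \<Rightarrow> real) \<Rightarrow> ennreal" where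
  "p_energy p \<mu> f =
     1 / 2 * (\<Sum>\<^sub>\<infinity>(x, y)\<in>UNIV \<times> UNIV. ennreal (\<mu> x y * \<bar>f x - f y\<bar> powr p))"

definition p_massive_function ::
  "real \<Rightarrow> ('v \<Rightarrow> 'v \<Rightarrow> bool) \<Rightarrow> ('v \<Rightarrow> 'v \<Rightarrow> real) \<Rightarrow> 'v set \<Rightarrow> ('v \<Rightarrow> real) \<Rightarrow> bool" where
  "p_massive_function p E \<mu> \<Omega> u \<longleftrightarrow>
     (\<forall>x\<in>\<Omega>. 0 < u x \<and> u x < 1) \<and> p_harmonic_on p E \<mu> \<Omega> u \<and> (\<forall>x\<in>- \<Omega>. u x = 1)"

definition p_massive ::
  "real \<Rightarrow> ('v \<Rightarrow> 'v \<Rightarrow> bool) \<Rightarrow> ('v \<Rightarrow> 'v \<Rightarrow> real) \<Rightarrow> 'v set \<Rightarrow> bool" where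
  "p_massive p E \<mu> \<Omega> \<longleftrightarrow> (\<exists>u. p_massive_function p E \<mu> \<Omega> u)"

definition Dp_massive ::
  "real \<Rightarrow> ('v \<Rightarrow> 'v \<Rightarrow> bool) \<Rightarrow> ('v \<Rightarrow> 'v \<Rightarrow> real) \<Rightarrow> 'v set \<Rightarrow> bool" where
  "Dp_massive p E \<mu> \<Omega> \<longleftrightarrow> (\<exists>u. p_massive_function p E \<mu> \<Omega> u \<and> p_energy p \<mu> u < \<infinity>)"

end

theory Submission
  imports Defs
begin

text \<open>Both equivalences rest on one device, relaxation (lemma \<open>relaxation\<close>): a function \<open>v\<close> that is
  subharmonic on \<open>\<Omega>\<close> and lies below a function \<open>s\<close> that is superharmonic on \<open>\<Omega>\<close> can be pushed up,
  without changing it outside \<open>\<Omega>\<close>, to a function \<open>h\<close> with \<open>v \<le> h \<le> s\<close> that is harmonic on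
  \<open>\<Omega>\<close> and has at most the energy of \<open>v\<close>. It is obtained by correcting one vertex at a time: the
  value at the vertex is raised until the Laplacian vanishes there. Such a step keeps the function
  subharmonic and below \<open>s\<close>, and it minimises the energy as a function of that one value, the energy
  being convex. When every vertex is visited infinitely often, the increasing limit is harmonic, and
  the energy bound passes to the limit since it only concerns finite partial sums. No Dirichlet
  problem on a finite subgraph has to be solved, and the statements with and without energy are
  proved together.

  If \<open>u\<close> is bounded, harmonic and not constant, choose \<open>m\<close> strictly between two of its values. The
  sets \<open>{u > m}\<close> and \<open>{u < m}\<close> are infinite by the maximum principle. Relaxing the
  positive part of \<open>u - m\<close> (divided by a bound) inside \<open>{u > m}\<close>, below the constant \<open>1\<close>, gives
  \<open>h\<close>, and \<open>1 - h\<close> shows that \<open>{u > m}\<close> is massive; the other set is treated with \<open>-u\<close>.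

  Conversely let \<open>u\<^sub>1, u\<^sub>2\<close> witness that the disjoint sets \<open>\<Omega>\<^sub>1, \<Omega>\<^sub>2\<close> are massive. Then
  \<open>1 - u\<^sub>1\<close> and \<open>1 - u\<^sub>2\<close> are subharmonic on the whole graph with disjoint supports. Once both are
  scaled to have supremum \<open>1\<close>, say to \<open>a\<^sub>1\<close> and \<open>a\<^sub>2\<close>, disjointness gives \<open>a\<^sub>1 \<le> 1 - a\<^sub>2\<close>, and
  relaxation on the whole graph gives a harmonic \<open>h\<close> with \<open>a\<^sub>1 \<le> h \<le> 1 - a\<^sub>2\<close>. The scaling
  is what makes \<open>h\<close> nonconstant: its supremum is \<open>1\<close> and its infimum is \<open>0\<close>.\<close>

section \<open>The nonlinearity\<close>

definition signed_powr :: "real \<Rightarrow> real \<Rightarrow> real" where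
  "signed_powr p t = \<bar>t\<bar> powr (p - 2) * t"

text \<open>Continuity and monotonicity, which for \<open>p < 2\<close> are hidden by the blow-up of
  \<open>\<bar>t\<bar> powr (p - 2)\<close> at \<open>0\<close>, are visible in this form.\<close>

lemma signed_powr_eq:
  "signed_powr p t = max t 0 powr (p - 1) - max (- t) 0 powr (p - 1)"
proof -
  have *: "r powr (p - 2) * r = r powr (p - 1)" if "r > 0" for r :: real
    using that powr_add[of r "p - 2" 1] by simp
  show ?thesis
    using *[of t] *[of "- t"] unfolding signed_powr_def
    by (cases t "0 :: real" rule: linorder_cases) auto
qed

lemma signed_powr_0 [simp]: "signed_powr p 0 = 0"
  by (simp add: signed_powr_def)

lemma signed_powr_mult: "signed_powr p (c * t) = signed_powr p c * signed_powr p t"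
  by (simp add: signed_powr_def abs_mult powr_mult)

lemma signed_powr_nonneg_iff [simp]: "signed_powr p t \<ge> 0 \<longleftrightarrow> t \<ge> 0"
  by (auto simp: signed_powr_def zero_le_mult_iff)

lemma signed_powr_eq_0_iff [simp]: "signed_powr p t = 0 \<longleftrightarrow> t = 0"
  by (auto simp: signed_powr_def)

lemma signed_powr_mono:
  assumes "1 < p" "s \<le> t"
  shows "signed_powr p s \<le> signed_powr p t"
  unfolding signed_powr_eq using assms by (intro diff_mono powr_mono2) auto

lemma continuous_on_signed_powr:
  assumes "1 < p"
  shows "continuous_on A (signed_powr p)"
proof -
  have "continuous_on A (\<lambda>t. max t 0 powr (p - 1) - max (- t) 0 powr (p - 1))"
    using assms by (intro continuous_intros continuous_on_powr') auto
  then show ?thesis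
    by (simp add: signed_powr_eq[abs_def])
qed

text \<open>The graph of the convex function \<open>\<bar>t\<bar> powr p\<close> lies above its tangents, whose slopes are
  \<open>p * signed_powr p a\<close>; this is Young's inequality.\<close>

lemma powr_above_tangent:
  assumes "1 < p"
  shows "\<bar>a\<bar> powr p + p * signed_powr p a * (b - a) \<le> \<bar>b\<bar> powr p"
proof -
  define q where "q = p / (p - 1)"
  have q: "q > 1" "1 / p + 1 / q = 1" "(p - 1) * q = p"
    using assms by (auto simp: q_def field_simps)
  have "\<bar>b\<bar> * (\<bar>a\<bar> powr (p - 1)) \<le> \<bar>b\<bar> powr p / p + (\<bar>a\<bar> powr (p - 1)) powr q / q"
    using assms q by (intro Youngs_inequality) auto
  then have young: "p * (\<bar>b\<bar> * (\<bar>a\<bar> powr (p - 1))) \<le> \<bar>b\<bar> powr p + (p - 1) * \<bar>a\<bar> powr p"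
    using assms by (simp add: powr_powr q) (simp add: q_def field_simps)
  have abs: "\<bar>signed_powr p a\<bar> = \<bar>a\<bar> powr (p - 1)"
    unfolding signed_powr_eq using assms by (cases a "0 :: real" rule: linorder_cases) auto
  have "signed_powr p a * b \<le> \<bar>signed_powr p a * b\<bar>"
    by simp
  also have "\<dots> = \<bar>b\<bar> * (\<bar>a\<bar> powr (p - 1))"
    by (simp add: abs_mult abs)
  finally have "p * (signed_powr p a * b) \<le> p * (\<bar>b\<bar> * (\<bar>a\<bar> powr (p - 1)))"
    using assms by (intro mult_left_mono) auto
  moreover have "signed_powr p a * a = \<bar>a\<bar> powr p"
  proof (cases "a = 0")
    case False
    then have "\<bar>a\<bar> powr p = \<bar>a\<bar> powr (p - 2) * \<bar>a\<bar> powr 2"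
      using powr_add[of "\<bar>a\<bar>" "p - 2" 2] by simp
    also have "\<bar>a\<bar> powr 2 = a * a"
      using False by (simp add: power2_eq_square)
    finally show ?thesis
      by (simp add: signed_powr_def)
  qed simp
  ultimately show ?thesis
    using young by (simp add: algebra_simps)
qed

section \<open>Energy\<close>

text \<open>Dropping the factor \<open>1 / 2\<close> leaves a plain supremum of finite partial sums.\<close>

definition double_energy :: "real \<Rightarrow> ('v \<Rightarrow> 'v \<Rightarrow> real) \<Rightarrow> ('v \<Rightarrow> real) \<Rightarrow> ennreal" where
  "double_energy p \<mu> f = (\<Sum>\<^sub>\<infinity>(x, y)\<in>UNIV. ennreal (\<mu> x y * \<bar>f x - f y\<bar> powr p))"

lemma p_energy_finite_iff: "p_energy p \<mu> f < \<infinity> \<longleftrightarrow> double_energy p \<mu> f < \<infinity>"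
proof -
  have energy: "p_energy p \<mu> f = 1 / 2 * double_energy p \<mu> f"
    by (simp add: p_energy_def double_energy_def)
  have "(1 / 2 :: ennreal) = ennreal (1 / 2)"
    using divide_ennreal[of 1 2] by simp
  then have "(1 / 2 :: ennreal) < top" "(1 / 2 :: ennreal) \<noteq> 0"
    using ennreal_less_top[of "1 / 2"] by (simp_all only: ennreal_eq_0_iff)
  then show ?thesis
    by (simp only: energy infinity_ennreal_def ennreal_mult_less_top simp_thms) auto
qed

lemma double_energy_le_iff:
  "double_energy p \<mu> f \<le> K \<longleftrightarrow>
     (\<forall>F. finite F \<longrightarrow> (\<Sum>(x, y)\<in>F. ennreal (\<mu> x y * \<bar>f x - f y\<bar> powr p)) \<le> K)"
  unfolding double_energy_def by (subst nonneg_infsum_complete) (auto simp: SUP_le_iff)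

text \<open>Scaling, reflection and cutting off a function are all Lipschitz operations on its values.\<close>

lemma double_energy_finite_lipschitz:
  assumes "1 < p" "C \<ge> 0" and nonneg: "\<And>x y. \<mu> x y \<ge> 0"
    and le: "\<And>x y. \<bar>f x - f y\<bar> \<le> C * \<bar>g x - g y\<bar>"
    and fin: "double_energy p \<mu> g < \<infinity>"
  shows "double_energy p \<mu> f < \<infinity>"
proof -
  have "double_energy p \<mu> f \<le> ennreal (C powr p) * double_energy p \<mu> g"
    unfolding double_energy_le_iff
  proof (intro allI impI)
    fix F :: "('a \<times> 'a) set"
    assume F: "finite F"
    have "(\<Sum>(x, y)\<in>F. ennreal (\<mu> x y * \<bar>f x - f y\<bar> powr p))
        \<le> (\<Sum>(x, y)\<in>F. ennreal (C powr p) * ennreal (\<mu> x y * \<bar>g x - g y\<bar> powr p))"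
    proof (intro sum_mono, clarify)
      fix x y
      have "\<bar>f x - f y\<bar> powr p \<le> (C * \<bar>g x - g y\<bar>) powr p"
        using assms by (intro powr_mono2) auto
      then have "\<mu> x y * \<bar>f x - f y\<bar> powr p \<le> \<mu> x y * (C * \<bar>g x - g y\<bar>) powr p"
        using nonneg by (intro mult_left_mono) auto
      then show "ennreal (\<mu> x y * \<bar>f x - f y\<bar> powr p)
          \<le> ennreal (C powr p) * ennreal (\<mu> x y * \<bar>g x - g y\<bar> powr p)"
        using assms by (simp add: powr_mult mult_ac ennreal_leI flip: ennreal_mult')
    qed
    also have "\<dots> = ennreal (C powr p) * (\<Sum>(x, y)\<in>F. ennreal (\<mu> x y * \<bar>g x - g y\<bar> powr p))"
      by (simp add: sum_distrib_left case_prod_unfold)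
    also have "\<dots> \<le> ennreal (C powr p) * double_energy p \<mu> g"
      using F double_energy_le_iff[of p \<mu> g "double_energy p \<mu> g"]
      by (intro mult_left_mono) auto
    finally show "(\<Sum>(x, y)\<in>F. ennreal (\<mu> x y * \<bar>f x - f y\<bar> powr p))
        \<le> ennreal (C powr p) * double_energy p \<mu> g" .
  qed
  also have "\<dots> < \<infinity>"
    using fin by (simp add: ennreal_mult_less_top)
  finally show ?thesis .
qed

text \<open>Each finite partial sum of the energy is continuous under pointwise convergence.\<close>

lemma double_energy_limit_le:
  assumes "1 < p" and le: "\<And>n. double_energy p \<mu> (u n) \<le> K"
    and lim: "\<And>x. (\<lambda>n. u n x) \<longlonglongrightarrow> h x"
  shows "double_energy p \<mu> h \<le> K"
  unfolding double_energy_le_iff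
proof (intro allI impI)
  fix F :: "('a \<times> 'a) set"
  assume F: "finite F"
  have "(\<lambda>n. \<mu> x y * \<bar>u n x - u n y\<bar> powr p) \<longlonglongrightarrow> \<mu> x y * \<bar>h x - h y\<bar> powr p" for x y
    using assms(1) by (intro tendsto_mult tendsto_powr' tendsto_intros lim) auto
  then have "(\<lambda>n. \<Sum>(x, y)\<in>F. ennreal (\<mu> x y * \<bar>u n x - u n y\<bar> powr p))
      \<longlonglongrightarrow> (\<Sum>(x, y)\<in>F. ennreal (\<mu> x y * \<bar>h x - h y\<bar> powr p))"
    unfolding case_prod_unfold by (intro tendsto_sum tendsto_ennrealI)
  then show "(\<Sum>(x, y)\<in>F. ennreal (\<mu> x y * \<bar>h x - h y\<bar> powr p)) \<le> K"
  proof (rule LIMSEQ_le_const2)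
    show "\<exists>N. \<forall>n\<ge>N. (\<Sum>(x, y)\<in>F. ennreal (\<mu> x y * \<bar>u n x - u n y\<bar> powr p)) \<le> K"
      using le F unfolding double_energy_le_iff by blast
  qed
qed

section \<open>Sub- and superharmonic functions\<close>

locale infinite_connected_graph = weighted_graph E \<mu>
  for E :: "'v \<Rightarrow> 'v \<Rightarrow> bool" and \<mu> :: "'v \<Rightarrow> 'v \<Rightarrow> real" +
  fixes p :: real
  assumes p_gt_1: "1 < p"
    and infinite_vertices: "infinite (UNIV :: 'v set)"
    and conn: "graph_connected E"
    and loc_finite: "locally_finite E"
begin

lemma finite_neighbours [simp]: "finite {y. E x y}"
  using loc_finite by (simp add: locally_finite_def)

lemma neighbour_closed_imp_UNIV:
  assumes "x \<in> S" and closed: "\<And>y z. y \<in> S \<Longrightarrow> E y z \<Longrightarrow> z \<in> S"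
  shows "S = UNIV"
proof -
  have "y \<in> S" if "E\<^sup>*\<^sup>* x y" for y
    using that by induction (use assms in auto)
  then show ?thesis
    using conn by (auto simp: graph_connected_def)
qed

lemma vertex_measure_pos: "vertex_measure E \<mu> x > 0"
proof -
  have "\<exists>y. E x y"
  proof (rule ccontr)
    assume "\<nexists>y. E x y"
    then have "{x} = UNIV"
      by (intro neighbour_closed_imp_UNIV) auto
    then show False
      using infinite_vertices by (metis finite.emptyI finite_insert)
  qed
  then show ?thesis
    unfolding vertex_measure_def
    by (intro sum_pos) (auto simp: weight_pos_iff)
qed

text \<open>Every vertex is the end of a walk that starts at a fixed vertex, and only finitely many
  vertices are reached by walks of a given length.\<close>

lemma countable_vertices: "countable (UNIV :: 'v set)"
proof -
  fix x :: 'v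
  have fin: "finite {y. (E ^^ n) x y}" for n
  proof (induction n)
    case (Suc n)
    have "{y. (E ^^ Suc n) x y} = (\<Union>z\<in>{z. (E ^^ n) x z}. {y. E z y})"
      by auto
    then show ?case
      using Suc by simp
  qed simp
  have "(UNIV :: 'v set) = (\<Union>n. {y. (E ^^ n) x y})"
    using conn unfolding graph_connected_def rtranclp_power by blast
  also have "countable \<dots>"
    using countable_finite[OF fin] by (intro countable_UN) auto
  finally show ?thesis .
qed

text \<open>The Laplacian without its positive factor; only its sign matters in the sequel.\<close>

definition flux :: "('v \<Rightarrow> real) \<Rightarrow> 'v \<Rightarrow> real" where
  "flux u x = (\<Sum>y | E x y. \<mu> x y * signed_powr p (u y - u x))"

lemma p_harmonic_on_iff: "p_harmonic_on p E \<mu> \<Omega> u \<longleftrightarrow> (\<forall>x\<in>\<Omega>. flux u x = 0)"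
proof -
  have "p_laplacian p E \<mu> u x = 1 / vertex_measure E \<mu> x * flux u x" for x
    by (simp add: p_laplacian_def flux_def grad_def signed_powr_def mult.assoc)
  then show ?thesis
    using vertex_measure_pos by (simp add: p_harmonic_on_def less_imp_neq[symmetric])
qed

lemma flux_affine: "flux (\<lambda>x. c * u x + d) x = signed_powr p c * flux u x"
proof -
  have "c * u y + d - (c * u x + d) = c * (u y - u x)" for y
    by (simp add: algebra_simps)
  then show ?thesis
    by (simp add: flux_def signed_powr_mult sum_distrib_left mult_ac)
qed

lemma flux_mono:
  assumes "\<And>y. E x y \<Longrightarrow> u y - u x \<le> w y - w x"
  shows "flux u x \<le> flux w x"
  unfolding flux_def
  using assms weight_nonneg p_gt_1 by (intro sum_mono mult_left_mono signed_powr_mono) auto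

lemma flux_nonneg: "(\<And>y. E x y \<Longrightarrow> u x \<le> u y) \<Longrightarrow> flux u x \<ge> 0"
  unfolding flux_def by (intro sum_nonneg mult_nonneg_nonneg weight_nonneg) auto

lemma flux_limit:
  assumes "\<And>x. (\<lambda>n. u n x) \<longlonglongrightarrow> h x"
  shows "(\<lambda>n. flux (u n) x) \<longlonglongrightarrow> flux h x"
  unfolding flux_def
proof (intro tendsto_sum tendsto_mult tendsto_const)
  fix y
  have "isCont (signed_powr p) (h y - h x)"
    using continuous_on_signed_powr[OF p_gt_1, of UNIV]
    by (simp add: continuous_on_eq_continuous_at)
  then show "(\<lambda>n. signed_powr p (u n y - u n x)) \<longlonglongrightarrow> signed_powr p (h y - h x)"
    by (rule isCont_tendsto_compose) (intro tendsto_diff assms)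
qed

text \<open>At a local maximum all summands of the flux are nonpositive, so a nonnegative flux forces
  each of them to vanish.\<close>

lemma subharmonic_max_neighbour:
  assumes "flux u x \<ge> 0" and max: "\<And>y. E x y \<Longrightarrow> u y \<le> u x" and "E x y"
  shows "u y = u x"
proof -
  have nonneg: "0 \<le> \<mu> x z * - signed_powr p (u z - u x)" if "E x z" for z
    using max[OF that] weight_nonneg[of x z] signed_powr_mono[OF p_gt_1, of "u z - u x" 0]
    by (intro mult_nonneg_nonneg) auto
  have "(\<Sum>z | E x z. \<mu> x z * - signed_powr p (u z - u x)) = - flux u x"
    by (simp add: flux_def sum_negf)
  moreover have "(\<Sum>z | E x z. \<mu> x z * - signed_powr p (u z - u x)) \<ge> 0"
    using nonneg by (intro sum_nonneg) auto
  ultimately have "(\<Sum>z | E x z. \<mu> x z * - signed_powr p (u z - u x)) = 0"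
    using assms(1) by linarith
  then have "\<mu> x y * - signed_powr p (u y - u x) = 0"
    using nonneg \<open>E x y\<close> by (subst (asm) sum_nonneg_eq_0_iff) auto
  moreover have "\<mu> x y > 0"
    using \<open>E x y\<close> weight_pos_iff by blast
  ultimately show ?thesis
    by simp
qed

section \<open>Relaxation\<close>

text \<open>As a function of the value at one vertex the energy is convex, and the flux there is its
  derivative up to a negative factor; so the energy is least where the flux vanishes. Only the edges
  at \<open>x\<close> are affected, and each of them occurs in the energy in both orientations.\<close>

lemma double_energy_harmonic_update_le:
  assumes "flux (u(x := t)) x = 0"
  shows "double_energy p \<mu> (u(x := t)) \<le> double_energy p \<mu> u"
proof -
  define w where "w = u(x := t)"
  define N where "N = {y. E x y}"
  define S where "S f = (\<Sum>y\<in>N. \<mu> x y * \<bar>f x - f y\<bar> powr p)" for f :: "'v \<Rightarrow> real"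
  define e where "e f = (\<lambda>(a, b). ennreal (\<mu> a b * \<bar>f a - f b\<bar> powr p))" for f :: "'v \<Rightarrow> real"
  define R where "R = - ({x} \<times> N \<union> (N - {x}) \<times> {x})"
  have finN: "finite N"
    by (simp add: N_def)
  have energy: "double_energy p \<mu> f = ennreal (S f) + ennreal (S f) + infsum (e f) R" for f
  proof -
    have sm: "e f summable_on X" for X
      by (rule nonneg_summable_on_complete) simp
    have S_nonneg: "0 \<le> \<mu> x y * \<bar>f x - f y\<bar> powr p" for y
      by (simp add: weight_nonneg)
    have "sum (e f) ({x} \<times> N) = (\<Sum>y\<in>N. e f (x, y))"
      by (rule sum.reindex_bij_witness[of _ "\<lambda>y. (x, y)" snd]) auto
    then have 1: "sum (e f) ({x} \<times> N) = ennreal (S f)"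
      using S_nonneg by (simp add: e_def S_def sum_ennreal)
    have "sum (e f) ((N - {x}) \<times> {x}) = (\<Sum>y\<in>N - {x}. e f (y, x))"
      by (rule sum.reindex_bij_witness[of _ "\<lambda>y. (y, x)" fst]) auto
    also have "\<dots> = (\<Sum>y\<in>N. ennreal (\<mu> x y * \<bar>f x - f y\<bar> powr p))"
      using finN weight_sym
      by (intro sum.mono_neutral_cong_left) (auto simp: e_def abs_minus_commute)
    also have "\<dots> = ennreal (S f)"
      using S_nonneg by (simp add: S_def sum_ennreal)
    finally have 2: "sum (e f) ((N - {x}) \<times> {x}) = ennreal (S f)" .
    have "double_energy p \<mu> f = infsum (e f) (({x} \<times> N \<union> (N - {x}) \<times> {x}) \<union> R)"
      by (simp only: double_energy_def e_def R_def Compl_partition)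
    also have "\<dots> = infsum (e f) ({x} \<times> N \<union> (N - {x}) \<times> {x}) + infsum (e f) R"
      by (intro infsum_Un_disjoint sm) (auto simp: R_def)
    also have "infsum (e f) ({x} \<times> N \<union> (N - {x}) \<times> {x})
        = infsum (e f) ({x} \<times> N) + infsum (e f) ((N - {x}) \<times> {x})"
      by (intro infsum_Un_disjoint sm) auto
    also have "\<dots> = ennreal (S f) + ennreal (S f)"
      using finN 1 2 by simp
    finally show ?thesis .
  qed
  have "infsum (e w) R = infsum (e u) R"
  proof (intro infsum_cong, clarify)
    fix a b
    assume R: "(a, b) \<in> R"
    have "\<mu> a b = 0" if "a \<noteq> b" "a = x \<or> b = x"
    proof -
      have "\<not> E a b"
        using R that edge_sym[of a b] by (auto simp: R_def N_def)
      then show ?thesis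
        using weight_pos_iff[of a b] weight_nonneg[of a b] by linarith
    qed
    then show "e w (a, b) = e u (a, b)"
      by (auto simp: e_def w_def)
  qed
  moreover have "S w \<le> S u"
  proof -
    have "S w = S w + p * (t - u x) * flux w x"
      using assms by (simp add: w_def)
    also have "\<dots> = (\<Sum>y\<in>N. \<mu> x y *
        (\<bar>w y - w x\<bar> powr p + p * signed_powr p (w y - w x) * (t - u x)))"
      unfolding S_def flux_def N_def sum_distrib_left sum.distrib[symmetric]
      by (intro sum.cong) (auto simp: algebra_simps abs_minus_commute)
    also have "\<dots> \<le> S u"
      unfolding S_def
    proof (intro sum_mono mult_left_mono weight_nonneg)
      fix y
      \<comment> \<open>A loop at \<open>x\<close> has gradient \<open>0\<close> before and after the update.\<close>
      show "\<bar>w y - w x\<bar> powr p + p * signed_powr p (w y - w x) * (t - u x) \<le> \<bar>u x - u y\<bar> powr p"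
        using powr_above_tangent[OF p_gt_1, of "w y - w x" "u y - u x"]
        by (cases "y = x") (auto simp: w_def abs_minus_commute)
    qed
    finally show ?thesis .
  qed
  ultimately show ?thesis
    unfolding w_def[symmetric] energy by (intro add_mono ennreal_leI) auto
qed

text \<open>The flux at \<open>x\<close> is continuous in the value at \<open>x\<close>. It is nonnegative for the value \<open>u x\<close>
  and nonpositive for the value \<open>s x\<close>, because there \<open>u\<close> touches \<open>s\<close> from below.\<close>

lemma exists_harmonic_update:
  assumes sub: "flux u x \<ge> 0" and super: "flux s x \<le> 0" and le: "\<And>y. u y \<le> s y"
  shows "\<exists>t. u x \<le> t \<and> t \<le> s x \<and> flux (u(x := t)) x = 0"
proof (rule IVT2')
  show "flux (u(x := s x)) x \<le> 0"
    using flux_mono[of x "u(x := s x)" s] super le by force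
  show "0 \<le> flux (u(x := u x)) x"
    using sub by simp
  show "u x \<le> s x"
    by (rule le)
  have "continuous_on A (\<lambda>t. signed_powr p ((u(x := t)) y - (u(x := t)) x))" for y A
    by (cases "y = x")
      (auto intro!: continuous_intros continuous_on_compose2[OF continuous_on_signed_powr[OF p_gt_1]])
  then show "continuous_on {u x..s x} (\<lambda>t. flux (u(x := t)) x)"
    unfolding flux_def by (intro continuous_intros)
qed

text \<open>The limit of the one-vertex corrections exists because they only increase the function and
  stay below \<open>s\<close>. Keeping \<open>h = v\<close> off \<open>\<Omega>\<close> prescribes boundary values; for \<open>\<Omega> = UNIV\<close> the
  two barriers \<open>v\<close> and \<open>s\<close> alone control \<open>h\<close>.\<close>

lemma relaxation:
  assumes sub: "\<And>x. x \<in> \<Omega> \<Longrightarrow> flux v x \<ge> 0"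
    and super: "\<And>x. x \<in> \<Omega> \<Longrightarrow> flux s x \<le> 0"
    and le: "\<And>x. v x \<le> s x"
  shows "\<exists>h. (\<forall>x. v x \<le> h x \<and> h x \<le> s x) \<and> (\<forall>x. x \<notin> \<Omega> \<longrightarrow> h x = v x) \<and>
    (\<forall>x\<in>\<Omega>. flux h x = 0) \<and> double_energy p \<mu> h \<le> double_energy p \<mu> v"
proof -
  \<comment> \<open>The second component of the decoded pair is a clock that brings every vertex back.\<close>
  define visit where "visit n = from_nat_into (UNIV :: 'v set) (fst (prod_decode n))" for n
  have visits: "\<exists>n\<ge>m. visit n = x" for x m
  proof -
    obtain i where "from_nat_into (UNIV :: 'v set) i = x"
      using from_nat_into_surj[OF countable_vertices, of x] by auto
    then have "visit (prod_encode (i, m)) = x"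
      by (simp add: visit_def)
    then show ?thesis
      using le_prod_encode_2 by blast
  qed
  define admissible where "admissible u \<longleftrightarrow> (\<forall>x. u x \<le> s x) \<and> (\<forall>x. x \<notin> \<Omega> \<longrightarrow> u x = v x) \<and>
    (\<forall>x\<in>\<Omega>. flux u x \<ge> 0) \<and> double_energy p \<mu> u \<le> double_energy p \<mu> v" for u
  have "\<exists>U. \<forall>n. (admissible (U n) \<and> (n = 0 \<longrightarrow> U n = v)) \<and> ((\<forall>x. U n x \<le> U (Suc n) x) \<and>
    (visit n \<in> \<Omega> \<longrightarrow> flux (U (Suc n)) (visit n) = 0))"
  proof (rule dependent_nat_choice)
    show "\<exists>u. admissible u \<and> ((0 :: nat) = 0 \<longrightarrow> u = v)"
      using sub le by (auto simp: admissible_def)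
  next
    fix u and n :: nat
    assume u: "admissible u \<and> (n = 0 \<longrightarrow> u = v)"
    let ?x = "visit n"
    show "\<exists>w. (admissible w \<and> (Suc n = 0 \<longrightarrow> w = v)) \<and> ((\<forall>x. u x \<le> w x) \<and>
      (?x \<in> \<Omega> \<longrightarrow> flux w ?x = 0))"
    proof (cases "?x \<in> \<Omega>")
      case True
      then obtain t where t: "u ?x \<le> t" "t \<le> s ?x" "flux (u(?x := t)) ?x = 0"
        using exists_harmonic_update[of u ?x s] u super by (auto simp: admissible_def)
      have "0 \<le> flux (u(?x := t)) z" if "z \<in> \<Omega>" for z
      proof (cases "z = ?x")
        case False
        \<comment> \<open>Raising the value at a neighbour can only increase the flux.\<close>
        then have "flux u z \<le> flux (u(?x := t)) z"
          using t by (intro flux_mono) auto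
        then show ?thesis
          using u that by (force simp: admissible_def)
      qed (use t in simp)
      then have "admissible (u(?x := t))"
        using u t True double_energy_harmonic_update_le[OF t(3)]
        by (auto simp: admissible_def)
      then show ?thesis
        using t by (intro exI[of _ "u(?x := t)"]) auto
    qed (use u in auto)
  qed
  then obtain U where U: "\<And>n. admissible (U n)" "U 0 = v"
    and inc: "\<And>n x. U n x \<le> U (Suc n) x"
    and harm: "\<And>n. visit n \<in> \<Omega> \<Longrightarrow> flux (U (Suc n)) (visit n) = 0"
    by metis
  have incseq: "incseq (\<lambda>n. U n x)" for x
    by (intro incseq_SucI inc)
  have "\<exists>l. (\<lambda>n. U n x) \<longlonglongrightarrow> l" for x
    using incseq_convergent[OF incseq[of x], of "s x"] U(1) by (metis admissible_def)
  then obtain h where lim: "\<And>x. (\<lambda>n. U n x) \<longlonglongrightarrow> h x"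
    by metis
  have "v x \<le> h x" for x
    using incseq_le[OF incseq[of x] lim[of x], of 0] U(2) by simp
  moreover have "h x \<le> s x" for x
    using U(1) by (intro LIMSEQ_le_const2[OF lim]) (auto simp: admissible_def)
  moreover have "h x = v x" if "x \<notin> \<Omega>" for x
  proof -
    have "(\<lambda>n. U n x) = (\<lambda>n. v x)"
      using U(1) that by (auto simp: admissible_def)
    then show ?thesis
      using lim[of x] by (simp add: LIMSEQ_const_iff)
  qed
  moreover have "flux h x = 0" if "x \<in> \<Omega>" for x
  proof (rule ccontr)
    \<comment> \<open>The flux of \<open>U n\<close> at \<open>x\<close> converges and vanishes for infinitely many \<open>n\<close>.\<close>
    assume "flux h x \<noteq> 0"
    then have "\<forall>\<^sub>F n in sequentially. flux (U n) x \<noteq> 0"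
      by (intro tendsto_imp_eventually_ne[OF flux_limit[OF lim]])
    then obtain m where m: "\<And>n. n \<ge> m \<Longrightarrow> flux (U n) x \<noteq> 0"
      by (auto simp: eventually_sequentially)
    obtain n where "n \<ge> m" "visit n = x"
      using visits by blast
    then show False
      using m[of "Suc n"] harm[of n] that by simp
  qed
  moreover have "double_energy p \<mu> h \<le> double_energy p \<mu> v"
    using U(1) by (intro double_energy_limit_le[OF p_gt_1 _ lim]) (simp add: admissible_def)
  ultimately show ?thesis
    by blast
qed

section \<open>Massive sets and bounded harmonic functions\<close>

text \<open>On a finite nonempty superlevel set \<open>u\<close> would attain its maximum over the whole graph, and
  the set of maximum points would spread along all edges.\<close>

lemma infinite_superlevel_set:
  assumes harm: "\<And>x. flux u x = 0" and "u a \<le> m" "m < u b"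
  shows "infinite {x. u x > m}"
proof
  assume fin: "finite {x. u x > m}"
  then have "Max (u ` {x. u x > m}) \<in> u ` {x. u x > m}"
    using \<open>m < u b\<close> by (intro Max_in) auto
  then obtain c where c: "u c > m" and "Max (u ` {x. u x > m}) = u c"
    by auto
  then have max: "u x \<le> u c" if "u x > m" for x
    using Max_ge[of "u ` {x. u x > m}" "u x"] fin that by auto
  have max': "u x \<le> u c" for x
    using c max[of x] by linarith
  have "{x. u x = u c} = UNIV"
  proof (rule neighbour_closed_imp_UNIV[of c])
    fix y z
    assume "y \<in> {x. u x = u c}" "E y z"
    then show "z \<in> {x. u x = u c}"
      using subharmonic_max_neighbour[of u y z] harm max' by simp
  qed simp
  then show False
    using c \<open>u a \<le> m\<close> by (metis UNIV_I mem_Collect_eq not_less)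
qed

text \<open>The positive part of \<open>u - m\<close> is only subharmonic on \<open>{u > m}\<close>, because the cut-off acts
  at neighbours outside the set; relaxation repairs this and keeps the boundary value \<open>0\<close>.\<close>

lemma superlevel_set_massive:
  assumes harm: "\<And>x. flux u x = 0" and bdd: "\<And>x. u x \<le> B" and "u a \<le> m" "m < u b"
  shows "\<exists>w. p_massive_function p E \<mu> {x. u x > m} w \<and>
    (double_energy p \<mu> u < \<infinity> \<longrightarrow> double_energy p \<mu> w < \<infinity>)"
proof -
  define \<Omega> where "\<Omega> = {x. u x > m}"
  define C where "C = B - m"
  define v where "v x = max (u x - m) 0 / C" for x
  have C: "C > 0"
    using bdd[of b] \<open>m < u b\<close> by (simp add: C_def)
  have "flux v x \<ge> 0" if "x \<in> \<Omega>" for x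
  proof -
    \<comment> \<open>Cutting off at \<open>0\<close> keeps the value at \<open>x\<close> and does not lower any other.\<close>
    have "0 \<le> flux (\<lambda>z. 1 / C * u z + - m / C) x"
      by (subst flux_affine) (simp add: harm)
    also have "\<dots> \<le> flux v x"
      using C that by (intro flux_mono) (auto simp: v_def \<Omega>_def field_simps)
    finally show ?thesis .
  qed
  moreover have "flux (\<lambda>_. 1) x \<le> 0" for x
    by (simp add: flux_def)
  moreover have "v x \<le> 1" for x
    using C bdd[of x] by (auto simp: v_def C_def)
  ultimately obtain h where h: "\<And>x. v x \<le> h x" "\<And>x. h x \<le> 1" "\<And>x. x \<notin> \<Omega> \<Longrightarrow> h x = v x"
    "\<And>x. x \<in> \<Omega> \<Longrightarrow> flux h x = 0" "double_energy p \<mu> h \<le> double_energy p \<mu> v"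
    using relaxation[of \<Omega> v "\<lambda>_. 1"] by blast
  have h0: "h x = 0" if "x \<notin> \<Omega>" for x
    using h(3)[OF that] that by (simp add: v_def \<Omega>_def)
  \<comment> \<open>A vertex with \<open>h = 1\<close> lies in \<open>\<Omega>\<close>, where \<open>h\<close> is harmonic, so the value \<open>1\<close> would spread
    over the whole graph; but \<open>h a = 0\<close>.\<close>
  have "h x \<noteq> 1" for x
  proof
    assume "h x = 1"
    then have "{z. h z = 1} = UNIV"
    proof (intro neighbour_closed_imp_UNIV[of x])
      fix y z
      assume y: "y \<in> {z. h z = 1}" "E y z"
      then have "y \<in> \<Omega>"
        using h0 by force
      then show "z \<in> {z. h z = 1}"
        using subharmonic_max_neighbour[of h y z] h y by simp
    qed simp
    moreover have "h a = 0"
      using h0 \<open>u a \<le> m\<close> by (simp add: \<Omega>_def)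
    ultimately show False
      by (metis UNIV_I mem_Collect_eq zero_neq_one)
  qed
  then have h1: "h x < 1" for x
    using h(2)[of x] by (simp add: less_le)
  have hpos: "h x > 0" if "x \<in> \<Omega>" for x
  proof -
    have "0 < v x"
      using C that by (simp add: v_def \<Omega>_def)
    then show ?thesis
      using h(1)[of x] by linarith
  qed
  have "p_massive_function p E \<mu> \<Omega> (\<lambda>x. 1 - h x)"
    using h0 h1 hpos h(4) flux_affine[of "-1" h 1]
    by (auto simp: p_massive_function_def p_harmonic_on_iff)
  moreover have "double_energy p \<mu> (\<lambda>x. 1 - h x) < \<infinity>" if fin: "double_energy p \<mu> u < \<infinity>"
  proof -
    have "\<bar>v x - v y\<bar> \<le> 1 / C * \<bar>u x - u y\<bar>" for x y
      using C by (simp add: v_def divide_right_mono flip: diff_divide_distrib)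
    then have "double_energy p \<mu> v < \<infinity>"
      using C p_gt_1 weight_nonneg fin
      by (intro double_energy_finite_lipschitz[of p "1 / C" \<mu> v u]) auto
    then have "double_energy p \<mu> h < \<infinity>"
      using h(5) by (rule le_less_trans[rotated])
    then show ?thesis
      using p_gt_1 weight_nonneg
      by (intro double_energy_finite_lipschitz[of p 1 \<mu> "\<lambda>x. 1 - h x" h]) auto
  qed
  ultimately show ?thesis
    unfolding \<Omega>_def by blast
qed

text \<open>Replacing \<open>u\<close> by \<open>-u\<close> turns the sublevel set into a superlevel set.\<close>

lemma harmonic_imp_massive_sets:
  assumes "p_harmonic_on p E \<mu> UNIV u" "bounded (range u)" "\<not> u constant_on UNIV"
  shows "\<exists>\<Omega>\<^sub>1 \<Omega>\<^sub>2 w\<^sub>1 w\<^sub>2. \<Omega>\<^sub>1 \<inter> \<Omega>\<^sub>2 = {} \<and> infinite \<Omega>\<^sub>1 \<and> infinite \<Omega>\<^sub>2 \<and>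
    p_massive_function p E \<mu> \<Omega>\<^sub>1 w\<^sub>1 \<and> p_massive_function p E \<mu> \<Omega>\<^sub>2 w\<^sub>2 \<and>
    (double_energy p \<mu> u < \<infinity> \<longrightarrow> double_energy p \<mu> w\<^sub>1 < \<infinity> \<and> double_energy p \<mu> w\<^sub>2 < \<infinity>)"
proof -
  have harm: "flux u x = 0" for x
    using assms(1) by (simp add: p_harmonic_on_iff)
  then have harm': "flux (\<lambda>x. - u x) x = 0" for x
    using flux_affine[of "-1" u 0 x] by simp
  obtain B where B: "\<And>x. \<bar>u x\<bar> \<le> B"
    using assms(2) by (auto simp: bounded_real)
  obtain a b where ab: "u a < u b"
    using assms(3) unfolding constant_on_def by (metis linorder_neq_iff)
  define m where "m = (u a + u b) / 2"
  have m: "u a < m" "m < u b"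
    using ab by (auto simp: m_def)
  have le: "u x \<le> B" "- u x \<le> B" for x
    using B[of x] by auto
  have set: "{x. - m < - u x} = {x. u x < m}"
    by auto
  obtain w\<^sub>1 where w1: "p_massive_function p E \<mu> {x. u x > m} w\<^sub>1"
    "double_energy p \<mu> u < \<infinity> \<longrightarrow> double_energy p \<mu> w\<^sub>1 < \<infinity>"
    using superlevel_set_massive[of u B a m b] harm le m by auto
  obtain w\<^sub>2 where w2: "p_massive_function p E \<mu> {x. u x < m} w\<^sub>2"
    "double_energy p \<mu> (\<lambda>x. - u x) < \<infinity> \<longrightarrow> double_energy p \<mu> w\<^sub>2 < \<infinity>"
    using superlevel_set_massive[of "\<lambda>x. - u x" B b "- m" a] harm' le m by (auto simp: set)
  have "infinite {x. u x > m}"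
    using infinite_superlevel_set[of u a m b] harm m by auto
  moreover have "infinite {x. u x < m}"
    using infinite_superlevel_set[of "\<lambda>x. - u x" b "- m" a] harm' m by (auto simp: set)
  moreover have "double_energy p \<mu> (\<lambda>x. - u x) = double_energy p \<mu> u"
    by (simp add: double_energy_def abs_minus_commute)
  moreover have "{x. u x > m} \<inter> {x. u x < m} = {}"
    by auto
  ultimately show ?thesis
    using w1 w2 by metis
qed

text \<open>Outside \<open>\<Omega>\<close> the function \<open>1 - u\<close> has a minimum, so it is subharmonic there as well.
  Dividing by its supremum, which is positive since \<open>\<Omega>\<close> is nonempty, gives \<open>a\<close>. The constant
  \<open>C\<close> serves to pass finiteness of the energy from \<open>u\<close> to \<open>a\<close>.\<close>

lemma massive_imp_normalized_subharmonic:
  assumes "p_massive_function p E \<mu> \<Omega> u" "\<Omega> \<noteq> {}"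
  obtains a C where "\<And>x. flux a x \<ge> 0" "\<And>x. 0 \<le> a x" "\<And>x. a x \<le> 1"
    "\<And>x. x \<notin> \<Omega> \<Longrightarrow> a x = 0" "\<And>c. c < 1 \<Longrightarrow> \<exists>x. c < a x"
    "C \<ge> 0" "\<And>x y. \<bar>a x - a y\<bar> \<le> C * \<bar>u x - u y\<bar>"
proof -
  have u: "\<And>x. x \<in> \<Omega> \<Longrightarrow> 0 < u x \<and> u x < 1 \<and> flux u x = 0" "\<And>x. x \<notin> \<Omega> \<Longrightarrow> u x = 1"
    using assms(1) by (auto simp: p_massive_function_def p_harmonic_on_iff)
  have u01: "0 \<le> 1 - u x" "1 - u x \<le> 1" for x
    using u[of x] by (cases "x \<in> \<Omega>"; force)+
  define S where "S = (SUP x. 1 - u x)"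
  have bdd: "bdd_above (range (\<lambda>x. 1 - u x))"
    using u01 by (intro bdd_aboveI[of _ 1]) auto
  have upper: "1 - u x \<le> S" for x
    unfolding S_def by (intro cSUP_upper bdd) auto
  obtain b where "b \<in> \<Omega>"
    using assms(2) by auto
  then have S: "S > 0"
    using upper[of b] u(1)[of b] by auto
  define a where "a x = (1 - u x) / S" for x
  have a_affine: "a = (\<lambda>x. (- 1 / S) * u x + 1 / S)"
    using S by (auto simp: a_def field_simps)
  have a_nonneg: "a x \<ge> 0" for x
    using u01 S by (simp add: a_def)
  have a_off: "a x = 0" if "x \<notin> \<Omega>" for x
    using u(2)[OF that] by (simp add: a_def)
  have "flux a x \<ge> 0" for x
  proof (cases "x \<in> \<Omega>")
    case True
    then show ?thesis
      unfolding a_affine flux_affine using u(1) by simp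
  next
    case False
    then show ?thesis
      using a_off a_nonneg by (intro flux_nonneg) auto
  qed
  moreover have "a x \<le> 1" for x
    using upper[of x] S by (simp add: a_def)
  moreover have "\<exists>x. c < a x" if "c < 1" for c
  proof -
    have "c * S < S"
      using that S by simp
    then obtain x where "c * S < 1 - u x"
      unfolding S_def using less_cSUP_iff[OF _ bdd, of "c * S"] by (auto simp: S_def)
    then have "c < a x"
      using S by (simp add: a_def field_simps)
    then show ?thesis ..
  qed
  moreover have "\<bar>a x - a y\<bar> \<le> 1 / S * \<bar>u x - u y\<bar>" for x y
    using S by (simp add: a_def abs_minus_commute flip: diff_divide_distrib)
  moreover have "1 / S \<ge> 0"
    using S by simp
  ultimately show ?thesis
    using a_nonneg a_off that by blast
qed

lemma massive_sets_imp_harmonic: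
  assumes "\<Omega>\<^sub>1 \<inter> \<Omega>\<^sub>2 = {}" "\<Omega>\<^sub>1 \<noteq> {}" "\<Omega>\<^sub>2 \<noteq> {}"
    and massive: "p_massive_function p E \<mu> \<Omega>\<^sub>1 u\<^sub>1" "p_massive_function p E \<mu> \<Omega>\<^sub>2 u\<^sub>2"
  shows "\<exists>h. p_harmonic_on p E \<mu> UNIV h \<and> bounded (range h) \<and> \<not> h constant_on UNIV \<and>
    (double_energy p \<mu> u\<^sub>1 < \<infinity> \<longrightarrow> double_energy p \<mu> h < \<infinity>)"
proof -
  obtain a\<^sub>1 C where a1: "\<And>x. flux a\<^sub>1 x \<ge> 0" "\<And>x. 0 \<le> a\<^sub>1 x" "\<And>x. a\<^sub>1 x \<le> 1"
    "\<And>x. x \<notin> \<Omega>\<^sub>1 \<Longrightarrow> a\<^sub>1 x = 0" "\<And>c. c < 1 \<Longrightarrow> \<exists>x. c < a\<^sub>1 x"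
    "C \<ge> 0" "\<And>x y. \<bar>a\<^sub>1 x - a\<^sub>1 y\<bar> \<le> C * \<bar>u\<^sub>1 x - u\<^sub>1 y\<bar>"
    by (rule massive_imp_normalized_subharmonic[OF massive(1) assms(2)]) (rule that)
  obtain a\<^sub>2 where a2: "\<And>x. flux a\<^sub>2 x \<ge> 0" "\<And>x. 0 \<le> a\<^sub>2 x" "\<And>x. a\<^sub>2 x \<le> 1"
    "\<And>x. x \<notin> \<Omega>\<^sub>2 \<Longrightarrow> a\<^sub>2 x = 0" "\<And>c. c < 1 \<Longrightarrow> \<exists>x. c < a\<^sub>2 x"
    by (rule massive_imp_normalized_subharmonic[OF massive(2) assms(3)]) (rule that)
  have "flux (\<lambda>x. 1 - a\<^sub>2 x) x \<le> 0" for x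
  proof -
    have "signed_powr p (- 1) = - 1"
      by (simp add: signed_powr_def)
    then show ?thesis
      using flux_affine[of "-1" a\<^sub>2 1 x] a2(1)[of x] by simp
  qed
  moreover have "a\<^sub>1 x \<le> 1 - a\<^sub>2 x" for x
  proof (cases "x \<in> \<Omega>\<^sub>1")
    case True
    then have "x \<notin> \<Omega>\<^sub>2"
      using assms(1) by auto
    then show ?thesis
      using a1(3)[of x] a2(4)[of x] by simp
  next
    case False
    then show ?thesis
      using a1(4)[of x] a2(3)[of x] by simp
  qed
  ultimately obtain h where h: "\<And>x. a\<^sub>1 x \<le> h x" "\<And>x. h x \<le> 1 - a\<^sub>2 x"
    "\<And>x. flux h x = 0" "double_energy p \<mu> h \<le> double_energy p \<mu> a\<^sub>1"
    using relaxation[of UNIV a\<^sub>1 "\<lambda>x. 1 - a\<^sub>2 x"] a1(1) by blast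
  have "\<bar>h x\<bar> \<le> 1" for x
    using h(1,2)[of x] a1(2)[of x] a2(2)[of x] by linarith
  then have "bounded (range h)"
    by (auto simp: bounded_real)
  moreover have "\<not> h constant_on UNIV"
  proof -
    obtain x y where "1 / 2 < a\<^sub>1 x" "1 / 2 < a\<^sub>2 y"
      using a1(5)[of "1 / 2"] a2(5)[of "1 / 2"] by auto
    then have "h y < h x"
      using h(1)[of x] h(2)[of y] by linarith
    then show ?thesis
      unfolding constant_on_def by (metis UNIV_I less_irrefl)
  qed
  moreover have "double_energy p \<mu> h < \<infinity>" if "double_energy p \<mu> u\<^sub>1 < \<infinity>"
    using double_energy_finite_lipschitz[OF p_gt_1 a1(6) weight_nonneg a1(7) that] h(4)
    by (rule le_less_trans[rotated])
  ultimately show ?thesis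
    using h(3) by (intro exI[of _ h]) (simp add: p_harmonic_on_iff)
qed

end

theorem theorem1p8:
  fixes p :: real
    and E :: "'v \<Rightarrow> 'v \<Rightarrow> bool"
    and \<mu> :: "'v \<Rightarrow> 'v \<Rightarrow> real"
  assumes "1 < p"
    and "weighted_graph E \<mu>"
    and "infinite (UNIV :: 'v set)"
    and "graph_connected E"
    and "locally_finite E"
  shows "((\<exists>u. p_harmonic_on p E \<mu> UNIV u \<and> bounded (range u) \<and> \<not> u constant_on UNIV) \<longleftrightarrow>
          (\<exists>\<Omega>\<^sub>1 \<Omega>\<^sub>2. \<Omega>\<^sub>1 \<inter> \<Omega>\<^sub>2 = {} \<and> infinite \<Omega>\<^sub>1 \<and> infinite \<Omega>\<^sub>2 \<and>
             p_massive p E \<mu> \<Omega>\<^sub>1 \<and> p_massive p E \<mu> \<Omega>\<^sub>2))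
       \<and> ((\<exists>u. p_harmonic_on p E \<mu> UNIV u \<and> bounded (range u) \<and> \<not> u constant_on UNIV \<and>
             p_energy p \<mu> u < \<infinity>) \<longleftrightarrow>
          (\<exists>\<Omega>\<^sub>1 \<Omega>\<^sub>2. \<Omega>\<^sub>1 \<inter> \<Omega>\<^sub>2 = {} \<and> infinite \<Omega>\<^sub>1 \<and> infinite \<Omega>\<^sub>2 \<and>
             Dp_massive p E \<mu> \<Omega>\<^sub>1 \<and> Dp_massive p E \<mu> \<Omega>\<^sub>2))"
proof -
  interpret infinite_connected_graph E \<mu> p
    using assms by (simp add: infinite_connected_graph_def infinite_connected_graph_axioms_def)
  have nonempty: "\<Omega> \<noteq> {}" if "infinite \<Omega>" for \<Omega> :: "'v set"
    using that by auto
  show ?thesis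
    unfolding p_energy_finite_iff Dp_massive_def p_massive_def
  proof (intro conjI iffI; elim exE conjE)
    fix u
    assume "p_harmonic_on p E \<mu> UNIV u" "bounded (range u)" "\<not> u constant_on UNIV"
    then show "\<exists>\<Omega>\<^sub>1 \<Omega>\<^sub>2. \<Omega>\<^sub>1 \<inter> \<Omega>\<^sub>2 = {} \<and> infinite \<Omega>\<^sub>1 \<and> infinite \<Omega>\<^sub>2 \<and>
        (\<exists>u. p_massive_function p E \<mu> \<Omega>\<^sub>1 u) \<and> (\<exists>u. p_massive_function p E \<mu> \<Omega>\<^sub>2 u)"
      using harmonic_imp_massive_sets[of u] by blast
  next
    fix u
    assume "p_harmonic_on p E \<mu> UNIV u" "bounded (range u)" "\<not> u constant_on UNIV"
      "double_energy p \<mu> u < \<infinity>"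
    then show "\<exists>\<Omega>\<^sub>1 \<Omega>\<^sub>2. \<Omega>\<^sub>1 \<inter> \<Omega>\<^sub>2 = {} \<and> infinite \<Omega>\<^sub>1 \<and> infinite \<Omega>\<^sub>2 \<and>
        (\<exists>u. p_massive_function p E \<mu> \<Omega>\<^sub>1 u \<and> double_energy p \<mu> u < \<infinity>) \<and>
        (\<exists>u. p_massive_function p E \<mu> \<Omega>\<^sub>2 u \<and> double_energy p \<mu> u < \<infinity>)"
      using harmonic_imp_massive_sets[of u] by blast
  next
    fix \<Omega>\<^sub>1 \<Omega>\<^sub>2 :: "'v set" and u\<^sub>1 u\<^sub>2
    assume "\<Omega>\<^sub>1 \<inter> \<Omega>\<^sub>2 = {}" "infinite \<Omega>\<^sub>1" "infinite \<Omega>\<^sub>2"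
      "p_massive_function p E \<mu> \<Omega>\<^sub>1 u\<^sub>1" "p_massive_function p E \<mu> \<Omega>\<^sub>2 u\<^sub>2"
    then show "\<exists>u. p_harmonic_on p E \<mu> UNIV u \<and> bounded (range u) \<and> \<not> u constant_on UNIV"
      using massive_sets_imp_harmonic[of \<Omega>\<^sub>1 \<Omega>\<^sub>2 u\<^sub>1 u\<^sub>2] nonempty by blast
  next
    fix \<Omega>\<^sub>1 \<Omega>\<^sub>2 :: "'v set" and u\<^sub>1 u\<^sub>2
    assume "\<Omega>\<^sub>1 \<inter> \<Omega>\<^sub>2 = {}" "infinite \<Omega>\<^sub>1" "infinite \<Omega>\<^sub>2"
      "p_massive_function p E \<mu> \<Omega>\<^sub>1 u\<^sub>1" "p_massive_function p E \<mu> \<Omega>\<^sub>2 u\<^sub>2"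
      "double_energy p \<mu> u\<^sub>1 < \<infinity>"
    then show "\<exists>u. p_harmonic_on p E \<mu> UNIV u \<and> bounded (range u) \<and> \<not> u constant_on UNIV \<and>
        double_energy p \<mu> u < \<infinity>"
      using massive_sets_imp_harmonic[of \<Omega>\<^sub>1 \<Omega>\<^sub>2 u\<^sub>1 u\<^sub>2] nonempty by blast
  qed
qed

end
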